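(* Let $\Gamma$ be a finite, undirected, connected graph without loops or multiple edges, with vertex set $X$, and let $x\in X$. Let $T=T(x)$ be the subconstituent algebra and $Q=Q(x)$ the quantum adjacency algebra of $\Gamma$ with respect to $x$. Then the following (i)--(iv) are equivalent: (i) $Q\neq T$; (ii) $Q\subsetneq T$; (iii) there exists a pair of nonisomorphic irreducible $T$-modules that are isomorphic as $Q$-modules; (iv) there exists a pair of quasi-isomorphic irreducible $T$-modules that have different endpoints.
   Context: $\mathrm{Mat}_X(\mathbb{C})$ is the $\mathbb{C}$-algebra of matrices with rows and columns indexed by $X$, acting by left multiplication on $V=\mathbb{C}^X$ (column vectors indexed by $X$). Subalgebras contain the identity $I$. Let $\partial$ be the path-length distance of $\Gamma$, $A\in\mathrm{Mat}_X(\mathbb{C})$ the adjacency matrix, and $D=\max\{\partial(x,y): y\in X\}$. For $0\le i\le D$, $E_i^*$ is the diagonal matrix with $(y,y)$-entry $1$ if $\partial(x,y)=i$ and $0$ otherwise; $E_i^*=0$ for integers $i$ outside $[0,D]$. $T=T(x)$ is the subalgebra of $\mathrm{Mat}_X(\mathbb{C})$ generated by $A$ and $E_0^*,\dots,E_D^*$ (the subconstituent algebra). Put $L=\sum_{i=1}^{D}E_{i-1}^*AE_i^*$, $F=\sum_{i=0}^{D}E_i^*AE_i^*$, $R=\sum_{i=0}^{D-1}E_{i+1}^*AE_i^*$. $Q=Q(x)$ is the subalgebra of $T$ generated by $L,F,R$ (the quantum adjacency algebra). For a subalgebra $S$ of $\mathrm{Mat}_X(\mathbb{C})$, an $S$-module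 is a subspace $W\subseteq V$ with $SW\subseteq W$; it is irreducible if $W\ne 0$ and it contains no $S$-module other than $0$ and $W$. An isomorphism of $S$-modules $U\to W$ is a vector space isomorphism $\sigma$ with $\sigma s=s\sigma$ on $U$ for all $s\in S$. Every $T$-module is a $Q$-module by restriction. The endpoint of an irreducible $T$-module $W$ is $r(W)=\min\{i: 0\le i\le D,\ E_i^*W\ne 0\}$. For irreducible $T$-modules $U,W$, a quasi-isomorphism of $T$-modules from $U$ to $W$ is a $\mathbb{C}$-linear bijection $\sigma:U\to W$ such that, on $U$, $\sigma L=L\sigma$, $\sigma F=F\sigma$, $\sigma R=R\sigma$, and $\sigma E_i^*=E_{i+n}^*\sigma$ for all $i\in\mathbb{Z}$, where $n=r(W)-r(U)$. $U$ and $W$ are quasi-isomorphic if such a $\sigma$ exists. *)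

theory Defs
  imports "HOL-Analysis.Analysis"
begin

section \<open>Graphs\<close>

text \<open>
  A finite graph without loops or multiple edges is a symmetric irreflexive adjacency relation on a
  finite type, whose universe is the vertex set \<open>X\<close>; \<open>'a\<close> is nonempty, like every type.
\<close>

definition connected_simple_graph :: "('a::finite \<Rightarrow> 'a \<Rightarrow> bool) \<Rightarrow> bool" where
  "connected_simple_graph adj \<longleftrightarrow>
     symp adj \<and> irreflp adj \<and> (\<forall>y z. adj\<^sup>*\<^sup>* y z)"

text \<open>
  \<open>(adj ^^ n) y z\<close> says that there is a walk of length \<open>n\<close> from \<open>y\<close> to \<open>z\<close>; a shortest walk is
  a path. The value is meaningful for connected graphs only.
\<close>

definition graph_dist :: "('a::finite \<Rightarrow> 'a \<Rightarrow> bool) \<Rightarrow> 'a \<Rightarrow> 'a \<Rightarrow> nat" where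
  "graph_dist adj y z = (LEAST n. (adj ^^ n) y z)"

definition eccentricity :: "('a::finite \<Rightarrow> 'a \<Rightarrow> bool) \<Rightarrow> 'a \<Rightarrow> nat" where
  "eccentricity adj x = Max (range (graph_dist adj x))"

section \<open>Matrices attached to a graph and a base vertex\<close>

definition adjacency_matrix :: "('a::finite \<Rightarrow> 'a \<Rightarrow> bool) \<Rightarrow> complex^'a^'a" where
  "adjacency_matrix adj = (\<chi> y z. if adj y z then 1 else 0)"

text \<open>
  The index of \<open>E\<^sup>*\<^sub>i\<close> is an integer. For \<open>i\<close> outside \<open>[0, D]\<close> no vertex is at distance \<open>i\<close>
  from \<open>x\<close>, so the formula gives the zero matrix there.
\<close>

definition Estar :: "('a::finite \<Rightarrow> 'a \<Rightarrow> bool) \<Rightarrow> 'a \<Rightarrow> int \<Rightarrow> complex^'a^'a" where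
  "Estar adj x i = (\<chi> y z. if y = z \<and> int (graph_dist adj x y) = i then 1 else 0)"

definition lowering :: "('a::finite \<Rightarrow> 'a \<Rightarrow> bool) \<Rightarrow> 'a \<Rightarrow> complex^'a^'a" where
  "lowering adj x = (\<Sum>i\<in>{1..int (eccentricity adj x)}.
     Estar adj x (i - 1) ** adjacency_matrix adj ** Estar adj x i)"

definition flat :: "('a::finite \<Rightarrow> 'a \<Rightarrow> bool) \<Rightarrow> 'a \<Rightarrow> complex^'a^'a" where
  "flat adj x = (\<Sum>i\<in>{0..int (eccentricity adj x)}.
     Estar adj x i ** adjacency_matrix adj ** Estar adj x i)"

definition raising :: "('a::finite \<Rightarrow> 'a \<Rightarrow> bool) \<Rightarrow> 'a \<Rightarrow> complex^'a^'a" where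
  "raising adj x = (\<Sum>i\<in>{0..int (eccentricity adj x) - 1}.
     Estar adj x (i + 1) ** adjacency_matrix adj ** Estar adj x i)"

section \<open>Matrix algebras and their modules\<close>

definition subalgebra :: "(complex^'a::finite^'a) set \<Rightarrow> bool" where
  "subalgebra S \<longleftrightarrow>
     mat 1 \<in> S \<and>
     (\<forall>M\<in>S. \<forall>N\<in>S. M + N \<in> S \<and> M ** N \<in> S) \<and>
     (\<forall>c. \<forall>M\<in>S. (\<chi> y z. c * M $ y $ z) \<in> S)"

definition subconstituent_algebra ::
    "('a::finite \<Rightarrow> 'a \<Rightarrow> bool) \<Rightarrow> 'a \<Rightarrow> (complex^'a^'a) set" where
  "subconstituent_algebra adj x =
     subalgebra hull
       insert (adjacency_matrix adj) (Estar adj x ` {0..int (eccentricity adj x)})"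

text \<open>
  As \<open>L\<close>, \<open>F\<close>, \<open>R\<close> lie in \<open>T\<close>, the subalgebra of \<open>T\<close> that they generate is the subalgebra of the
  full matrix algebra that they generate.
\<close>

definition quantum_adjacency_algebra ::
    "('a::finite \<Rightarrow> 'a \<Rightarrow> bool) \<Rightarrow> 'a \<Rightarrow> (complex^'a^'a) set" where
  "quantum_adjacency_algebra adj x =
     subalgebra hull {lowering adj x, flat adj x, raising adj x}"

definition is_module :: "(complex^'a::finite^'a) set \<Rightarrow> (complex^'a) set \<Rightarrow> bool" where
  "is_module S W \<longleftrightarrow> vec.subspace W \<and> (\<forall>M\<in>S. \<forall>w\<in>W. M *v w \<in> W)"

definition irreducible_module :: "(complex^'a::finite^'a) set \<Rightarrow> (complex^'a) set \<Rightarrow> bool" where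
  "irreducible_module S W \<longleftrightarrow>
     is_module S W \<and> W \<noteq> {0} \<and>
     (\<forall>W'. is_module S W' \<and> W' \<subseteq> W \<longrightarrow> W' = {0} \<or> W' = W)"

text \<open>
  Maps between submodules are represented by functions on the whole space, of which only the
  values on the domain \<open>U\<close> matter.
\<close>

definition vector_space_iso ::
    "(complex^'a::finite) set \<Rightarrow> (complex^'a) set \<Rightarrow> (complex^'a \<Rightarrow> complex^'a) \<Rightarrow> bool" where
  "vector_space_iso U W \<sigma> \<longleftrightarrow>
     bij_betw \<sigma> U W \<and>
     (\<forall>u\<in>U. \<forall>v\<in>U. \<sigma> (u + v) = \<sigma> u + \<sigma> v) \<and>
     (\<forall>c. \<forall>u\<in>U. \<sigma> (c *s u) = c *s \<sigma> u)"

definition isomorphic_modules ::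
    "(complex^'a::finite^'a) set \<Rightarrow> (complex^'a) set \<Rightarrow> (complex^'a) set \<Rightarrow> bool" where
  "isomorphic_modules S U W \<longleftrightarrow>
     (\<exists>\<sigma>. vector_space_iso U W \<sigma> \<and> (\<forall>M\<in>S. \<forall>u\<in>U. \<sigma> (M *v u) = M *v \<sigma> u))"

section \<open>Endpoints and quasi-isomorphisms\<close>

definition endpoint :: "('a::finite \<Rightarrow> 'a \<Rightarrow> bool) \<Rightarrow> 'a \<Rightarrow> (complex^'a) set \<Rightarrow> int" where
  "endpoint adj x W =
     Min {i \<in> {0..int (eccentricity adj x)}. (\<lambda>w. Estar adj x i *v w) ` W \<noteq> {0}}"

definition quasi_isomorphism ::
    "('a::finite \<Rightarrow> 'a \<Rightarrow> bool) \<Rightarrow> 'a \<Rightarrow> (complex^'a) set \<Rightarrow> (complex^'a) set \<Rightarrow>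
       (complex^'a \<Rightarrow> complex^'a) \<Rightarrow> bool" where
  "quasi_isomorphism adj x U W \<sigma> \<longleftrightarrow>
     vector_space_iso U W \<sigma> \<and>
     (\<forall>u\<in>U. \<sigma> (lowering adj x *v u) = lowering adj x *v \<sigma> u) \<and>
     (\<forall>u\<in>U. \<sigma> (flat adj x *v u) = flat adj x *v \<sigma> u) \<and>
     (\<forall>u\<in>U. \<sigma> (raising adj x *v u) = raising adj x *v \<sigma> u) \<and>
     (\<forall>i. \<forall>u\<in>U. \<sigma> (Estar adj x i *v u) =
        Estar adj x (i + (endpoint adj x W - endpoint adj x U)) *v \<sigma> u)"

definition quasi_isomorphic ::
    "('a::finite \<Rightarrow> 'a \<Rightarrow> bool) \<Rightarrow> 'a \<Rightarrow> (complex^'a) set \<Rightarrow> (complex^'a) set \<Rightarrow> bool" where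
  "quasi_isomorphic adj x U W \<longleftrightarrow> (\<exists>\<sigma>. quasi_isomorphism adj x U W \<sigma>)"

end

theory Submission
  imports Defs "HOL-Computational_Algebra.Fundamental_Theorem_Algebra"
begin

text \<open>
  Let \<open>K\<close> be the diagonal matrix whose \<open>(y, y)\<close> entry is the distance from \<open>x\<close> to \<open>y\<close>. The \<open>E\<^sup>*\<^sub>i\<close> are
  its spectral projections, hence polynomials in it, and \<open>A = L + F + R\<close>; so \<open>T\<close> is generated by \<open>Q\<close>
  and \<open>K\<close>. The commutators of \<open>K\<close> with \<open>L\<close>, \<open>F\<close>, \<open>R\<close> are \<open>-L\<close>, \<open>0\<close>, \<open>R\<close>, so that \<open>K\<close> induces a derivation
  of \<open>Q\<close>. Moreover \<open>Q\<close> is closed under the conjugate transpose. Orthogonal projection of matrices to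
  \<open>Q\<close>, for the Hermitian form \<open>tr (M N\<^sup>*)\<close>, is therefore a map of \<open>Q\<close>-bimodules, and the projection \<open>K'\<close>
  of \<open>K\<close> induces the same derivation of \<open>Q\<close> as \<open>K\<close> does. Consequently \<open>Z = K - K'\<close> is central in \<open>T\<close>
  (\<open>Z_central\<close>), and \<open>T\<close> is generated by \<open>Q\<close> and \<open>Z\<close>.

  By Schur's lemma \<open>Z\<close> acts as a scalar on each irreducible \<open>T\<close>-module, which is therefore also
  irreducible as a \<open>Q\<close>-module. Two irreducible \<open>T\<close>-modules are isomorphic if and only if they are
  isomorphic as \<open>Q\<close>-modules and \<open>Z\<close> acts on them by the same scalar. An isomorphism of \<open>Q\<close>-modules
  between them commutes with \<open>K'\<close>, so it shifts \<open>K\<close> by the difference of the two scalars. The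
  eigenvalues of \<open>K\<close> are integers, so the shift is an integer; it is the difference of the endpoints
  and the map is a quasi-isomorphism (\<open>Q_iso_shifts_Estar\<close>, \<open>endpoint_shift\<close>). So a pair of
  \<open>Q\<close>-isomorphic modules is the same as a quasi-isomorphic pair, and the modules are nonisomorphic
  over \<open>T\<close> exactly when their endpoints differ.

  It remains to find the two modules when \<open>Q \<noteq> T\<close>. By the double commutant argument, some
  endomorphism of the \<open>Q\<close>-module \<open>V\<close> does not commute with \<open>Z\<close>: otherwise \<open>Z\<close> would equal its
  projection to \<open>Q\<close>, which is zero, and \<open>K\<close> would lie in \<open>Q\<close> (\<open>exists_block_not_commuting\<close>). As \<open>V\<close> is
  the sum of its irreducible \<open>T\<close>-modules, this endomorphism has a nonzero component between two of
  them on which \<open>Z\<close> acts by different scalars (\<open>exists_Q_iso_not_T_iso\<close>).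
\<close>

section \<open>Matrix arithmetic and the conjugate transpose\<close>

definition cscale :: "complex \<Rightarrow> complex^'a::finite^'a \<Rightarrow> complex^'a^'a" where
  "cscale c M = (\<chi> y z. c * M $ y $ z)"

definition conj_transpose :: "complex^'a::finite^'a \<Rightarrow> complex^'a^'a" where
  "conj_transpose M = (\<chi> y z. cnj (M $ z $ y))"

lemma cscale_mult_vec: "cscale c M *v v = c *s (M *v v)"
  by (simp add: cscale_def vec_eq_iff matrix_vector_mult_def sum_distrib_left mult.assoc)

lemma cscale_mult_left: "cscale c M ** N = cscale c (M ** N)"
  by (simp add: cscale_def vec_eq_iff matrix_matrix_mult_def sum_distrib_left mult.assoc)

lemma cscale_mult_right: "M ** cscale c N = cscale c (M ** N)"
  by (simp add: cscale_def vec_eq_iff matrix_matrix_mult_def sum_distrib_left mult.left_commute)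

lemma matrix_add_rdistrib_complex: "(M + N) ** P = M ** P + N ** (P :: complex^'a::finite^'a)"
  by (simp add: vec_eq_iff matrix_matrix_mult_def distrib_right sum.distrib)

lemma matrix_diff_ldistrib_complex: "P ** (M - N) = P ** M - P ** (N :: complex^'a::finite^'a)"
  by (simp add: vec_eq_iff matrix_matrix_mult_def right_diff_distrib sum_subtractf)

lemma matrix_diff_rdistrib_complex: "(M - N) ** P = M ** P - N ** (P :: complex^'a::finite^'a)"
  by (simp add: vec_eq_iff matrix_matrix_mult_def left_diff_distrib sum_subtractf)

lemma matrix_vector_diff_complex: "(M - N) *v v = M *v v - N *v (v :: complex^'a::finite)"
  by (simp add: vec_eq_iff matrix_vector_mult_def left_diff_distrib sum_subtractf)

lemma column_matrix_mult: "column y (M ** N) = M *v column y (N :: complex^'a::finite^'a)"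
  by (simp add: vec_eq_iff column_def matrix_vector_mult_def matrix_matrix_mult_def)

lemma conj_transpose_add: "conj_transpose (M + N) = conj_transpose M + conj_transpose N"
  by (simp add: conj_transpose_def vec_eq_iff)

lemma conj_transpose_mult: "conj_transpose (M ** N) = conj_transpose N ** conj_transpose M"
  by (simp add: conj_transpose_def vec_eq_iff matrix_matrix_mult_def mult.commute)

lemma conj_transpose_cscale: "conj_transpose (cscale c M) = cscale (cnj c) (conj_transpose M)"
  by (simp add: conj_transpose_def cscale_def vec_eq_iff)

lemma conj_transpose_mat_1: "conj_transpose (mat 1) = mat 1"
  by (auto simp: conj_transpose_def mat_def vec_eq_iff)

lemma inner_complex_eq: "a \<bullet> b = Re (a * cnj b)"
  by (simp add: inner_complex_def)

lemma inner_matrix_vector: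
  fixes M :: "complex^'a::finite^'a"
  shows "(M *v u) \<bullet> v = u \<bullet> (conj_transpose M *v v)"
proof -
  have "(M *v u) \<bullet> v = Re (\<Sum>i\<in>UNIV. \<Sum>j\<in>UNIV. M $ i $ j * u $ j * cnj (v $ i))"
    by (simp add: inner_vec_def inner_complex_eq matrix_vector_mult_def sum_distrib_right del: times_complex.sel)
  also have "\<dots> = Re (\<Sum>j\<in>UNIV. \<Sum>i\<in>UNIV. M $ i $ j * u $ j * cnj (v $ i))"
    by (subst sum.swap) simp
  also have "\<dots> = u \<bullet> (conj_transpose M *v v)"
    by (simp add: inner_vec_def inner_complex_eq matrix_vector_mult_def sum_distrib_left
        conj_transpose_def mult_ac del: times_complex.sel)
  finally show ?thesis .
qed

lemma inner_vector_scale: "(c *s u) \<bullet> v = u \<bullet> (cnj c *s (v :: complex^'a::finite))"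
  by (simp add: inner_vec_def inner_complex_eq mult_ac del: times_complex.sel)

lemma inner_cscale: "cscale c M \<bullet> N = M \<bullet> cscale (cnj c) N"
  by (simp add: inner_vec_def inner_complex_eq cscale_def mult_ac del: times_complex.sel)

lemma inner_matrix_left_mult:
  fixes M N P :: "complex^'a::finite^'a"
  shows "(M ** N) \<bullet> P = N \<bullet> (conj_transpose M ** P)"
proof -
  have columns: "N \<bullet> P = (\<Sum>j\<in>UNIV. column j N \<bullet> column j P)" for N P :: "complex^'a^'a"
    by (simp add: inner_vec_def column_def) (rule sum.swap)
  show ?thesis
    by (simp add: columns column_matrix_mult inner_matrix_vector)
qed

lemma inner_matrix_right_mult:
  fixes M N P :: "complex^'a::finite^'a"
  shows "(N ** M) \<bullet> P = N \<bullet> (P ** conj_transpose M)"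
proof -
  have row: "(N ** M) $ i = transpose M *v (N $ i)" for N M :: "complex^'a^'a" and i
    by (simp add: vec_eq_iff matrix_vector_mult_def matrix_matrix_mult_def transpose_def mult.commute)
  have "conj_transpose (transpose M) = transpose (conj_transpose M)"
    by (simp add: conj_transpose_def transpose_def vec_eq_iff)
  then show ?thesis
    by (simp add: inner_vec_def[of "N ** M"] inner_vec_def[of N] row inner_matrix_vector
        del: transpose_matrix_vector)
qed

section \<open>Orthogonal projections\<close>

text \<open>
  The projection for the real inner product, the real part of the Hermitian form. A complex subspace
  has the same orthogonal complement for both, so this is then the Hermitian projection.
\<close>

definition proj :: "'b::euclidean_space set \<Rightarrow> 'b \<Rightarrow> 'b" where
  "proj S v = (SOME p. p \<in> S \<and> (\<forall>w\<in>S. (v - p) \<bullet> w = 0))"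

lemma
  assumes "subspace S"
  shows proj_in: "proj S v \<in> S"
    and proj_orthogonal: "w \<in> S \<Longrightarrow> (v - proj S v) \<bullet> w = 0"
proof -
  obtain p z where "p \<in> span S" "\<And>w. w \<in> span S \<Longrightarrow> orthogonal z w" "v = p + z"
    using orthogonal_subspace_decomp_exists[of S v] by metis
  then have "\<exists>p. p \<in> S \<and> (\<forall>w\<in>S. (v - p) \<bullet> w = 0)"
    using assms by (auto simp: span_eq_iff[THEN iffD2] orthogonal_def intro!: exI[of _ p])
  then have "proj S v \<in> S \<and> (\<forall>w\<in>S. (v - proj S v) \<bullet> w = 0)"
    unfolding proj_def by (rule someI_ex)
  then show "proj S v \<in> S" "w \<in> S \<Longrightarrow> (v - proj S v) \<bullet> w = 0" by auto
qed

lemma proj_unique: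
  assumes S: "subspace S" and p: "p \<in> S" "\<And>w. w \<in> S \<Longrightarrow> (v - p) \<bullet> w = 0"
  shows "proj S v = p"
proof -
  define d where "d = proj S v - p"
  have "d \<in> S" unfolding d_def using S p(1) proj_in[OF S] by (simp add: subspace_diff)
  then have "(v - p) \<bullet> d - (v - proj S v) \<bullet> d = 0"
    using p(2) proj_orthogonal[OF S] by simp
  then have "d \<bullet> d = 0" unfolding d_def by (simp add: inner_diff_left)
  then show ?thesis by (simp add: d_def)
qed

lemma proj_add:
  assumes "subspace S"
  shows "proj S (u + v) = proj S u + proj S v"
proof (rule proj_unique[OF assms])
  show "proj S u + proj S v \<in> S"
    using assms by (simp add: subspace_add proj_in)
  fix w assume "w \<in> S"
  then show "(u + v - (proj S u + proj S v)) \<bullet> w = 0"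
    using proj_orthogonal[OF assms, of w u] proj_orthogonal[OF assms, of w v]
    by (simp add: algebra_simps)
qed

text \<open>
  A map that preserves \<open>S\<close> and has an adjoint that does so too also preserves the orthogonal
  complement. This covers multiplication by a matrix on either side and complex scalars.
\<close>

lemma proj_commute:
  assumes S: "subspace S"
    and "\<And>u v. f (u - v) = f u - f v"
    and "\<And>v. v \<in> S \<Longrightarrow> f v \<in> S"
    and "\<And>u v. f u \<bullet> v = u \<bullet> g v"
    and "\<And>v. v \<in> S \<Longrightarrow> g v \<in> S"
  shows "proj S (f v) = f (proj S v)"
proof (rule proj_unique[OF S])
  show "f (proj S v) \<in> S" by (simp add: assms proj_in)
  fix w assume "w \<in> S"
  then have "(v - proj S v) \<bullet> g w = 0" by (simp add: assms proj_orthogonal[OF S])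
  then show "(f v - f (proj S v)) \<bullet> w = 0" by (simp only: assms(4) flip: assms(2))
qed

lemma complex_subspace_imp_subspace:
  assumes "vec.subspace (W :: (complex^'a::finite) set)"
  shows "subspace W"
proof -
  have "c *\<^sub>R v = of_real c *s v" for c and v :: "complex^'a"
    by (simp add: vec_eq_iff scaleR_conv_of_real[where 'a=complex])
  then show ?thesis
    using assms by (simp add: subspace_def vec.subspace_def)
qed

section \<open>Eigenvectors in invariant subspaces\<close>

text \<open>The vector \<open>p(M) w\<close>, by Horner's scheme.\<close>

definition poly_act :: "complex^'a::finite^'a \<Rightarrow> complex^'a \<Rightarrow> complex poly \<Rightarrow> complex^'a" where
  "poly_act M w p = fold_coeffs (\<lambda>a v. a *s w + M *v v) p 0"

lemma poly_act_0 [simp]: "poly_act M w 0 = 0"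
  by (simp add: poly_act_def)

lemma poly_act_pCons: "poly_act M w (pCons a p) = a *s w + M *v poly_act M w p"
  by (cases "p = 0"; cases "a = 0")
    (simp_all add: poly_act_def fold_coeffs_pCons_not_0_0_eq fold_coeffs_pCons_coeff_not_0_eq)

lemma poly_act_add: "poly_act M w (p + q) = poly_act M w p + poly_act M w q"
  by (induction p q rule: poly_induct2)
    (simp_all add: poly_act_pCons matrix_vector_right_distrib vec.scale_left_distrib)

lemma poly_act_smult: "poly_act M w (smult c p) = c *s poly_act M w p"
  by (induction p)
    (simp_all add: poly_act_pCons vector_scalar_commute vec.scale_right_distrib)

lemma poly_act_sum: "poly_act M w (\<Sum>i\<in>I. f i) = (\<Sum>i\<in>I. poly_act M w (f i))"
  by (induction I rule: infinite_finite_induct) (simp_all add: poly_act_add)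

lemma poly_act_linear_factor:
  "poly_act M w ([:-c, 1:] * q) = M *v poly_act M w q - c *s poly_act M w q"
proof -
  have "[:-c, 1:] * q = pCons 0 q + smult (- c) q" by simp
  then show ?thesis
    by (simp only: poly_act_add poly_act_smult poly_act_pCons) simp
qed

lemma poly_act_mem:
  assumes "vec.subspace W" "\<And>v. v \<in> W \<Longrightarrow> M *v v \<in> W" "w \<in> W"
  shows "poly_act M w p \<in> W"
  by (induction p)
    (simp_all add: poly_act_pCons assms vec.subspace_0 vec.subspace_add vec.subspace_scale)

text \<open>
  Otherwise the vectors \<open>M\<^sup>i w\<close> for \<open>i\<close> up to the dimension would be distinct and independent.
\<close>

lemma exists_annihilating_poly:
  fixes M :: "complex^'a::finite^'a"
  obtains p where "p \<noteq> 0" "poly_act M w p = 0"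
proof -
  have False if none: "\<And>p. poly_act M w p = 0 \<Longrightarrow> p = 0"
  proof -
    let ?N = "vec.dim (UNIV :: (complex^'a) set)"
    let ?f = "\<lambda>i. poly_act M w (monom 1 i)"
    have inj: "inj_on ?f {..?N}"
    proof (rule inj_onI)
      fix i j assume "?f i = ?f j"
      then have "poly_act M w (monom 1 i + smult (- 1) (monom 1 j)) = 0"
        by (simp only: poly_act_add poly_act_smult) simp
      then have "monom 1 i + smult (- 1) (monom 1 j) = (0 :: complex poly)" by (rule none)
      then have "monom 1 i = (monom 1 j :: complex poly)" by simp
      then show "i = j" by (simp add: monom_eq_iff')
    qed
    have "vec.dim (?f ` {..?N}) \<le> ?N" by (rule vec.dim_subset) simp
    also have "?N < card (?f ` {..?N})" unfolding card_image[OF inj] card_atMost by simp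
    finally have "vec.dim (?f ` {..?N}) < card (?f ` {..?N})" .
    then have "vec.dependent (?f ` {..?N})"
      using vec.dependent_biggerset_general by blast
    then obtain u k where k: "k \<le> ?N" "u (?f k) \<noteq> 0"
      and sum0: "(\<Sum>v\<in>?f ` {..?N}. u v *s v) = 0"
      by (auto simp: vec.dependent_finite)
    let ?p = "\<Sum>i\<le>?N. smult (u (?f i)) (monom 1 i)"
    have "poly_act M w ?p = (\<Sum>i\<le>?N. u (?f i) *s ?f i)"
      by (simp only: poly_act_sum poly_act_smult)
    also have "\<dots> = 0"
      using sum0 unfolding sum.reindex[OF inj] comp_def .
    finally have "?p = 0" by (rule none)
    then have "coeff ?p k = 0" by simp
    moreover have "coeff ?p k = u (?f k)"
      using k(1) by (simp add: coeff_sum smult_monom)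
    ultimately show False using k(2) by simp
  qed
  then show ?thesis using that by blast
qed

text \<open>
  If \<open>p\<close> is a nonzero polynomial of least degree with \<open>p(M) w = 0\<close> and \<open>p = (X - c) q\<close>, then \<open>q(M) w\<close> is
  nonzero and is an eigenvector for \<open>c\<close>.
\<close>

lemma exists_eigenvector:
  fixes M :: "complex^'a::finite^'a"
  assumes W: "vec.subspace W" "\<And>v. v \<in> W \<Longrightarrow> M *v v \<in> W" and w: "w \<in> W" "w \<noteq> 0"
  obtains c v where "v \<in> W" "v \<noteq> 0" "M *v v = c *s v"
proof -
  let ?P = "\<lambda>p. p \<noteq> 0 \<and> poly_act M w p = 0"
  obtain p0 where "?P p0" using exists_annihilating_poly[of M w] by metis
  then obtain p where p: "?P p" and least: "\<And>q. ?P q \<Longrightarrow> degree p \<le> degree q"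
    using exists_least_iff[of "\<lambda>n. \<exists>p. ?P p \<and> degree p = n"] by (metis not_le_imp_less)
  have "degree p \<noteq> 0"
  proof
    assume "degree p = 0"
    then obtain a where "p = [:a:]" by (rule degree_eq_zeroE)
    with p w(2) show False by (simp add: poly_act_pCons)
  qed
  then obtain c where "poly p c = 0"
    using fundamental_theorem_of_algebra[of p] by (auto simp: constant_degree)
  then obtain q where q: "p = [:-c, 1:] * q" by (auto simp: poly_eq_0_iff_dvd)
  then have "q \<noteq> 0" using p by auto
  then have "degree q < degree p" unfolding q by (subst degree_mult_eq) auto
  then have "poly_act M w q \<noteq> 0" using least[of q] \<open>q \<noteq> 0\<close> by auto
  moreover have "M *v poly_act M w q = c *s poly_act M w q"
    using p unfolding q poly_act_linear_factor by simp
  ultimately show ?thesis using that poly_act_mem[OF W w(1)] by blast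
qed

section \<open>Subalgebras and their modules\<close>

lemma subalgebra_iff:
  "subalgebra S \<longleftrightarrow> mat 1 \<in> S \<and> (\<forall>M\<in>S. \<forall>N\<in>S. M + N \<in> S \<and> M ** N \<in> S) \<and>
     (\<forall>c. \<forall>M\<in>S. cscale c M \<in> S)"
  by (simp add: subalgebra_def cscale_def)

lemma subalgebraI:
  assumes "mat 1 \<in> S" "\<And>M N. M \<in> S \<Longrightarrow> N \<in> S \<Longrightarrow> M + N \<in> S"
    "\<And>M N. M \<in> S \<Longrightarrow> N \<in> S \<Longrightarrow> M ** N \<in> S" "\<And>c M. M \<in> S \<Longrightarrow> cscale c M \<in> S"
  shows "subalgebra S"
  using assms by (simp add: subalgebra_iff)

lemma
  assumes "subalgebra S"
  shows subalgebra_one: "mat 1 \<in> S"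
    and subalgebra_add: "M \<in> S \<Longrightarrow> N \<in> S \<Longrightarrow> M + N \<in> S"
    and subalgebra_mult: "M \<in> S \<Longrightarrow> N \<in> S \<Longrightarrow> M ** N \<in> S"
    and subalgebra_cscale: "M \<in> S \<Longrightarrow> cscale c M \<in> S"
  using assms by (auto simp: subalgebra_iff)

lemma subalgebra_zero:
  assumes "subalgebra S"
  shows "0 \<in> S"
  using subalgebra_cscale[OF assms subalgebra_one[OF assms], of 0]
  by (simp add: cscale_def zero_vec_def)

lemma subalgebra_diff:
  assumes "subalgebra S" "M \<in> S" "N \<in> S"
  shows "M - N \<in> S"
proof -
  have "M - N = M + cscale (- 1) N" by (simp add: cscale_def vec_eq_iff)
  then show ?thesis
    using assms by (simp only: subalgebra_add subalgebra_cscale)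
qed

lemma subalgebra_sum:
  assumes "subalgebra S" "\<And>i. i \<in> I \<Longrightarrow> f i \<in> S"
  shows "(\<Sum>i\<in>I. f i) \<in> S"
  using assms(2)
  by (induction I rule: infinite_finite_induct)
    (simp_all add: subalgebra_zero[OF assms(1)] subalgebra_add[OF assms(1)])

lemma subalgebra_imp_subspace:
  assumes "subalgebra S"
  shows "subspace S"
proof -
  have "c *\<^sub>R M = cscale (of_real c) M" for c and M :: "complex^'a::finite^'a"
    by (simp add: cscale_def vec_eq_iff scaleR_conv_of_real[where 'a=complex])
  then show ?thesis
    using assms by (simp add: subspace_def subalgebra_zero subalgebra_add subalgebra_cscale)
qed

lemma subalgebra_hull: "subalgebra (subalgebra hull s)"
  by (rule hull_in) (simp add: subalgebra_def Ball_def)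

lemma subalgebra_stabilizer:
  assumes "vec.subspace W"
  shows "subalgebra {M. \<forall>w\<in>W. M *v w \<in> W}"
  by (rule subalgebraI)
    (simp_all add: matrix_vector_mult_add_rdistrib cscale_mult_vec assms vec.subspace_add
      vec.subspace_scale flip: matrix_vector_mul_assoc)

lemma subalgebra_commutant: "subalgebra {M. M ** Z = Z ** M}" (is "subalgebra ?C")
proof (rule subalgebraI)
  show "mat 1 \<in> ?C" by simp
next
  fix M N assume "M \<in> ?C" "N \<in> ?C"
  then show "M + N \<in> ?C" "M ** N \<in> ?C"
    by (simp_all add: matrix_add_rdistrib_complex matrix_add_ldistrib)
      (metis matrix_mul_assoc)
next
  fix c M assume "M \<in> ?C"
  then show "cscale c M \<in> ?C"
    by (simp add: cscale_mult_left cscale_mult_right)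
qed

lemma subalgebra_conj_transpose:
  assumes "subalgebra S"
  shows "subalgebra {M. conj_transpose M \<in> S}"
  by (rule subalgebraI)
    (simp_all add: conj_transpose_add conj_transpose_mult conj_transpose_cscale
      conj_transpose_mat_1 assms subalgebra_one subalgebra_add subalgebra_mult subalgebra_cscale)

text \<open>By the Leibniz rule, a commutator map has to be checked on generators only.\<close>

lemma subalgebra_commutator_in:
  assumes S: "subalgebra S"
  shows "subalgebra {M \<in> S. K ** M - M ** K \<in> S}" (is "subalgebra ?D")
proof (rule subalgebraI)
  show "mat 1 \<in> ?D"
    by (simp add: subalgebra_one[OF S] subalgebra_zero[OF S])
next
  fix M N assume "M \<in> ?D" "N \<in> ?D"
  then have M: "M \<in> S" "K ** M - M ** K \<in> S" and N: "N \<in> S" "K ** N - N ** K \<in> S"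
    by auto
  have "K ** (M + N) - (M + N) ** K = (K ** M - M ** K) + (K ** N - N ** K)"
    by (simp add: matrix_add_ldistrib matrix_add_rdistrib_complex)
  then show "M + N \<in> ?D"
    using M N by (simp add: subalgebra_add[OF S])
  have "K ** (M ** N) - M ** N ** K = (K ** M - M ** K) ** N + M ** (K ** N - N ** K)"
    by (simp add: matrix_diff_ldistrib_complex matrix_diff_rdistrib_complex matrix_mul_assoc)
  then show "M ** N \<in> ?D"
    using M N by (simp add: subalgebra_add[OF S] subalgebra_mult[OF S])
next
  fix c M assume "M \<in> ?D"
  then have M: "M \<in> S" "K ** M - M ** K \<in> S" by auto
  have "K ** cscale c M - cscale c M ** K = cscale c (K ** M - M ** K)"
    by (simp add: cscale_mult_left cscale_mult_right)
      (simp add: cscale_def vec_eq_iff right_diff_distrib)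
  then show "cscale c M \<in> ?D"
    using M by (simp add: subalgebra_cscale[OF S])
qed

lemma subalgebra_intertwiners:
  assumes U: "vec.subspace U" and iso: "vector_space_iso U W \<sigma>"
  shows "subalgebra {M. \<forall>u\<in>U. M *v u \<in> U \<and> \<sigma> (M *v u) = M *v \<sigma> u}"
  using iso unfolding vector_space_iso_def
  by (intro subalgebraI)
    (simp_all add: matrix_vector_mult_add_rdistrib cscale_mult_vec U vec.subspace_add
      vec.subspace_scale flip: matrix_vector_mul_assoc)

lemma is_moduleD:
  assumes "is_module S W"
  shows "vec.subspace W" "M \<in> S \<Longrightarrow> w \<in> W \<Longrightarrow> M *v w \<in> W"
  using assms by (auto simp: is_module_def)

lemma irreducible_moduleD:
  assumes "irreducible_module S W"
  shows "is_module S W" "vec.subspace W" "W \<noteq> {0}"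
    "is_module S W' \<Longrightarrow> W' \<subseteq> W \<Longrightarrow> W' \<noteq> {0} \<Longrightarrow> W' = W"
  using assms by (auto simp: irreducible_module_def is_module_def)

lemma irreducible_module_nonzero_vector:
  assumes "irreducible_module S W"
  obtains w where "w \<in> W" "w \<noteq> 0"
  using irreducible_moduleD(2,3)[OF assms] vec.subspace_0 by blast

text \<open>A nonzero submodule of least dimension is irreducible.\<close>

lemma exists_irreducible_submodule:
  assumes "is_module S N" "N \<noteq> {0}"
  obtains W where "irreducible_module S W" "W \<subseteq> N"
proof -
  let ?P = "\<lambda>W. is_module S W \<and> W \<noteq> {0} \<and> W \<subseteq> N"
  obtain W where W: "?P W" and least: "\<And>W'. ?P W' \<Longrightarrow> vec.dim W \<le> vec.dim W'"
    using exists_least_iff[of "\<lambda>n. \<exists>W. ?P W \<and> vec.dim W = n"] assms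
    by (metis not_le_imp_less subset_refl)
  have "W' = W" if W': "is_module S W'" "W' \<subseteq> W" "W' \<noteq> {0}" for W'
  proof (rule vec.subspace_dim_equal)
    show "vec.dim W \<le> vec.dim W'" using W W' by (intro least) auto
  qed (use W W' in \<open>auto dest: is_moduleD(1)\<close>)
  then have "irreducible_module S W"
    using W by (auto simp: irreducible_module_def)
  then show ?thesis using that W by blast
qed

text \<open>The orthogonal projection onto a module of a self-adjoint algebra is a module map.\<close>

lemma proj_mult_vec:
  assumes W: "is_module S W" and star: "\<And>M. M \<in> S \<Longrightarrow> conj_transpose M \<in> S" and M: "M \<in> S"
  shows "proj W (M *v v) = M *v proj W v"
proof (rule proj_commute[where g = "\<lambda>v. conj_transpose M *v v"])
  show "subspace W" using W by (intro complex_subspace_imp_subspace is_moduleD(1))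
qed (use W M star in \<open>auto simp: matrix_vector_mult_diff_distrib inner_matrix_vector intro: is_moduleD(2)\<close>)

lemma proj_vector_scale:
  assumes "vec.subspace (W :: (complex^'a::finite) set)"
  shows "proj W (c *s v) = c *s proj W v"
  by (rule proj_commute[where g = "\<lambda>v. cnj c *s v"])
    (use assms in \<open>auto simp: complex_subspace_imp_subspace vec.scale_right_diff_distrib
      inner_vector_scale vec.subspace_scale\<close>)

text \<open>
  Complete reducibility: the orthogonal complement of the sum of all irreducible modules is a
  module that contains no irreducible module, so it vanishes.
\<close>

lemma span_irreducible_modules:
  assumes star: "\<And>M. M \<in> S \<Longrightarrow> conj_transpose M \<in> S"
  shows "vec.span (\<Union>{W. irreducible_module S W}) = UNIV"
proof -
  let ?V = "vec.span (\<Union>{W. irreducible_module S W})"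
  define N where "N = {v. \<forall>W. irreducible_module S W \<longrightarrow> (\<forall>w\<in>W. v \<bullet> w = 0)}"
  have scale_inner: "(c *s v) \<bullet> w = 0" if "v \<in> N" "irreducible_module S W" "w \<in> W" for c v w W
    using that irreducible_moduleD(2)[OF that(2)]
    by (auto simp: N_def inner_vector_scale vec.subspace_scale)
  have "vec.subspace N"
    using scale_inner by (intro vec.subspaceI) (auto simp: N_def inner_add_left)
  moreover have "M *v v \<in> N" if "M \<in> S" "v \<in> N" for M v
    using that star irreducible_moduleD(1) is_moduleD(2)
    by (fastforce simp: N_def inner_matrix_vector)
  ultimately have N: "is_module S N" by (simp add: is_module_def)
  have "N = {0}"
  proof (rule ccontr)
    assume "N \<noteq> {0}"
    then obtain W where W: "irreducible_module S W" "W \<subseteq> N"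
      using exists_irreducible_submodule[OF N] by metis
    obtain w where "w \<in> W" "w \<noteq> 0" using irreducible_module_nonzero_vector[OF W(1)] .
    then have "w \<in> N" using W by blast
    then have "w \<bullet> w = 0" using W(1) \<open>w \<in> W\<close> unfolding N_def by blast
    with \<open>w \<noteq> 0\<close> show False by simp
  qed
  moreover have "v - proj ?V v \<in> N" for v
    unfolding N_def
  proof (intro CollectI allI impI ballI)
    fix W w assume "irreducible_module S W" "w \<in> W"
    then have "w \<in> ?V" by (auto intro: vec.span_base)
    then show "(v - proj ?V v) \<bullet> w = 0"
      by (rule proj_orthogonal[OF complex_subspace_imp_subspace[OF vec.subspace_span]])
  qed
  ultimately have "v = proj ?V v" for v by auto
  then have "v \<in> ?V" for v
    using proj_in[OF complex_subspace_imp_subspace[OF vec.subspace_span]] by metis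
  then show ?thesis by blast
qed

lemma subspace_covering_irreducibles:
  assumes "\<And>M. M \<in> S \<Longrightarrow> conj_transpose M \<in> S"
    and P: "vec.subspace P" "\<And>W. irreducible_module S W \<Longrightarrow> W \<subseteq> P"
  shows "v \<in> P"
proof -
  have "vec.span (\<Union>{W. irreducible_module S W}) \<subseteq> P"
    using P by (intro vec.span_minimal) auto
  then show ?thesis using span_irreducible_modules[OF assms(1)] by auto
qed

text \<open>Schur's lemma for maps between irreducible modules: kernel and image are submodules.\<close>

lemma schur_iso:
  assumes U: "irreducible_module S U" and W: "irreducible_module S W"
    and add: "\<And>u v. \<phi> (u + v) = \<phi> u + \<phi> v" and scale: "\<And>c u. \<phi> (c *s u) = c *s \<phi> u"
    and into: "\<And>u. u \<in> U \<Longrightarrow> \<phi> u \<in> W"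
    and comm: "\<And>M u. M \<in> S \<Longrightarrow> \<phi> (M *v u) = M *v \<phi> u"
    and nonzero: "u0 \<in> U" "\<phi> u0 \<noteq> 0"
  shows "isomorphic_modules S U W"
proof -
  note Um = irreducible_moduleD(1,2)[OF U]
  have zero: "\<phi> 0 = 0" using scale[of 0 0] by simp
  have "is_module S {u \<in> U. \<phi> u = 0}"
    unfolding is_module_def
    by (auto intro!: vec.subspaceI simp: add scale zero comm Um vec.subspace_0 vec.subspace_add
        vec.subspace_scale is_moduleD(2)[OF Um(1)])
  then have kernel: "{u \<in> U. \<phi> u = 0} = {0}"
    using irreducible_moduleD(4)[OF U] nonzero by blast
  have diff: "\<phi> (u - v) = \<phi> u - \<phi> v" for u v
    using add[of "u - v" v] by simp
  have inj: "inj_on \<phi> U"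
  proof (rule inj_onI)
    fix u v assume "u \<in> U" "v \<in> U" "\<phi> u = \<phi> v"
    then have "u - v \<in> {u \<in> U. \<phi> u = 0}"
      using vec.subspace_diff[OF Um(2)] by (simp add: diff)
    then show "u = v" unfolding kernel by simp
  qed
  have "is_module S (\<phi> ` U)"
    unfolding is_module_def
  proof (intro conjI ballI vec.subspaceI)
    show "0 \<in> \<phi> ` U" using zero vec.subspace_0[OF Um(2)] by force
  next
    fix v w assume "v \<in> \<phi> ` U" "w \<in> \<phi> ` U"
    then show "v + w \<in> \<phi> ` U"
      using vec.subspace_add[OF Um(2)] by (auto simp flip: add)
  next
    fix c v assume "v \<in> \<phi> ` U"
    then show "c *s v \<in> \<phi> ` U"
      using vec.subspace_scale[OF Um(2)] by (auto simp flip: scale)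
  next
    fix M v assume "M \<in> S" "v \<in> \<phi> ` U"
    then show "M *v v \<in> \<phi> ` U"
      using is_moduleD(2)[OF Um(1)] by (auto simp flip: comm)
  qed
  then have "\<phi> ` U = W"
    using into nonzero by (intro irreducible_moduleD(4)[OF W]) auto
  then have "vector_space_iso U W \<phi>"
    using inj by (simp add: vector_space_iso_def bij_betw_def add scale)
  then show ?thesis
    using comm by (auto simp: isomorphic_modules_def)
qed

text \<open>Schur's lemma for central elements: an eigenspace is a nonzero submodule.\<close>

lemma central_acts_as_scalar:
  assumes W: "irreducible_module S W" and "Z \<in> S"
    and central: "\<And>M. M \<in> S \<Longrightarrow> M ** Z = Z ** M"
  obtains c where "\<And>w. w \<in> W \<Longrightarrow> Z *v w = c *s w"
proof -
  note Wm = irreducible_moduleD(1,2)[OF W]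
  obtain w where "w \<in> W" "w \<noteq> 0" using irreducible_module_nonzero_vector[OF W] .
  then obtain c v where v: "v \<in> W" "v \<noteq> 0" "Z *v v = c *s v"
    using exists_eigenvector[OF Wm(2) is_moduleD(2)[OF Wm(1) \<open>Z \<in> S\<close>]] by metis
  have "Z *v (M *v u) = c *s (M *v u)" if "M \<in> S" "Z *v u = c *s u" for M u
    using that central[OF that(1)] by (metis matrix_vector_mul_assoc vector_scalar_commute)
  then have "is_module S {w \<in> W. Z *v w = c *s w}"
    unfolding is_module_def
    by (auto intro!: vec.subspaceI simp: Wm vec.subspace_0 vec.subspace_add vec.subspace_scale
        is_moduleD(2)[OF Wm(1)] matrix_vector_right_distrib vec.scale_right_distrib
        vector_scalar_commute mult.commute)
  then have "{w \<in> W. Z *v w = c *s w} = W"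
    using v by (intro irreducible_moduleD(4)[OF W]) auto
  then show ?thesis using that by blast
qed

section \<open>Adjoining a matrix that induces a derivation of a self-adjoint algebra\<close>

text \<open>
  The construction of the central matrix and of two modules that only \<open>T\<close> tells apart depends on no
  more than this. For the subconstituent algebra, \<open>K\<close> is the
  diagonal matrix of distances to the base vertex, which generates the same algebra as the
  \<open>E\<^sup>*\<^sub>i\<close>.
\<close>

locale derivation_extension =
  fixes Q T :: "(complex^'a::finite^'a) set" and K :: "complex^'a^'a"
  assumes Q: "subalgebra Q" and T: "subalgebra T"
    and Q_star: "M \<in> Q \<Longrightarrow> conj_transpose M \<in> Q"
    and K_star: "conj_transpose K = K"
    and Q_subset_T: "Q \<subseteq> T" and K_in_T: "K \<in> T"
    and commutator_in_Q: "M \<in> Q \<Longrightarrow> K ** M - M ** K \<in> Q"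
    and T_minimal: "subalgebra S \<Longrightarrow> Q \<subseteq> S \<Longrightarrow> K \<in> S \<Longrightarrow> T \<subseteq> S"
begin

lemma T_star: "M \<in> T \<Longrightarrow> conj_transpose M \<in> T"
  using T_minimal[OF subalgebra_conj_transpose[OF T]] Q_star Q_subset_T K_star K_in_T by auto

text \<open>
  Subtracting from \<open>K\<close> its projection \<open>K'\<close> onto \<open>Q\<close> leaves a central matrix: \<open>K\<close> and \<open>K'\<close> induce the
  same derivation of \<open>Q\<close>.
\<close>

definition Z :: "complex^'a^'a" where
  "Z = K - proj Q K"

lemma K_minus_Z_in_Q: "K - Z \<in> Q"
  by (simp add: Z_def proj_in subalgebra_imp_subspace[OF Q])

lemma Z_in_T: "Z \<in> T"
  using K_minus_Z_in_Q Q_subset_T subalgebra_diff[OF T K_in_T, of "K - Z"] by auto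

lemma proj_left_mult:
  assumes "M \<in> Q"
  shows "proj Q (M ** N) = M ** proj Q N"
  by (rule proj_commute[where g = "\<lambda>N. conj_transpose M ** N"])
    (simp_all add: assms subalgebra_imp_subspace Q Q_star subalgebra_mult[OF Q]
      matrix_diff_ldistrib_complex inner_matrix_left_mult)

lemma proj_right_mult:
  assumes "M \<in> Q"
  shows "proj Q (N ** M) = proj Q N ** M"
  by (rule proj_commute[where g = "\<lambda>N. N ** conj_transpose M"])
    (simp_all add: assms subalgebra_imp_subspace Q Q_star subalgebra_mult[OF Q]
      matrix_diff_rdistrib_complex inner_matrix_right_mult)

lemma proj_cscale: "proj Q (cscale c N) = cscale c (proj Q N)"
proof (rule proj_commute[where g = "cscale (cnj c)"])
  show "cscale c (M - N) = cscale c M - cscale c N" for M N :: "complex^'a^'a"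
    by (simp add: cscale_def vec_eq_iff right_diff_distrib)
qed (simp_all add: subalgebra_imp_subspace Q subalgebra_cscale inner_cscale)

lemma proj_fixed: "M \<in> Q \<Longrightarrow> proj Q M = M"
  by (rule proj_unique) (simp_all add: subalgebra_imp_subspace Q)

lemma proj_Z: "proj Q Z = 0"
proof (rule proj_unique)
  show "(Z - 0) \<bullet> M = 0" if "M \<in> Q" for M
    using proj_orthogonal[OF subalgebra_imp_subspace[OF Q] that] by (simp add: Z_def)
qed (simp_all add: subalgebra_imp_subspace Q subalgebra_zero)

text \<open>
  The commutator \<open>K M - M K\<close> lies in \<open>Q\<close>, so the projection fixes it. As the projection is a map of
  \<open>Q\<close>-bimodules, it also sends this commutator to \<open>K' M - M K'\<close> with \<open>K' = proj Q K\<close>.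
\<close>

lemma Z_commutes_with_Q:
  assumes "M \<in> Q"
  shows "M ** Z = Z ** M"
proof -
  have "K ** M = (K ** M - M ** K) + M ** K" by simp
  then have "proj Q (K ** M) = (K ** M - M ** K) + proj Q (M ** K)"
    by (metis proj_add subalgebra_imp_subspace Q proj_fixed commutator_in_Q assms)
  then show ?thesis
    by (simp add: proj_left_mult[OF assms] proj_right_mult[OF assms] Z_def
        matrix_diff_ldistrib_complex matrix_diff_rdistrib_complex algebra_simps)
qed

lemma Z_central:
  assumes "M \<in> T"
  shows "M ** Z = Z ** M"
proof -
  have "(K - Z) ** Z = Z ** (K - Z)" by (rule Z_commutes_with_Q[OF K_minus_Z_in_Q])
  then have "K ** Z = Z ** K"
    by (simp add: matrix_diff_ldistrib_complex matrix_diff_rdistrib_complex)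
  then have "T \<subseteq> {M. M ** Z = Z ** M}"
    by (intro T_minimal subalgebra_commutant) (auto simp: Z_commutes_with_Q)
  then show ?thesis using assms by blast
qed

lemma T_subset_if_Z:
  assumes "subalgebra S" "Q \<subseteq> S" "Z \<in> S"
  shows "T \<subseteq> S"
proof (rule T_minimal[OF assms(1,2)])
  show "K \<in> S" using subalgebra_add[OF assms(1), of "K - Z" Z] K_minus_Z_in_Q assms by auto
qed

lemma Z_eq_0_imp_Q_eq_T: "Z = 0 \<Longrightarrow> Q = T"
  using T_subset_if_Z[OF Q] subalgebra_zero[OF Q] Q_subset_T by auto

definition eigenvalue :: "(complex^'a) set \<Rightarrow> complex" where
  "eigenvalue W = (SOME c. \<forall>w\<in>W. Z *v w = c *s w)"

lemma Z_eigenvalue: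
  assumes "irreducible_module T W" "w \<in> W"
  shows "Z *v w = eigenvalue W *s w"
proof -
  obtain c where "\<And>w. w \<in> W \<Longrightarrow> Z *v w = c *s w"
    using central_acts_as_scalar[OF assms(1) Z_in_T Z_central] by metis
  then have "\<exists>c. \<forall>w\<in>W. Z *v w = c *s w" by blast
  then have "\<forall>w\<in>W. Z *v w = eigenvalue W *s w" unfolding eigenvalue_def by (rule someI_ex)
  then show ?thesis using assms(2) by blast
qed

lemma T_module_imp_Q_module: "is_module T W \<Longrightarrow> is_module Q W"
  using Q_subset_T by (auto simp: is_module_def)

text \<open>
  As \<open>Z\<close> acts as a scalar, it preserves every subspace, so that \<open>Q\<close>-submodules are \<open>T\<close>-submodules.
\<close>

lemma irreducible_T_imp_irreducible_Q:
  assumes W: "irreducible_module T W"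
  shows "irreducible_module Q W"
proof -
  have "W' = {0} \<or> W' = W" if W': "is_module Q W'" "W' \<subseteq> W" for W'
  proof -
    note sub = is_moduleD(1)[OF W'(1)]
    have "Z *v w \<in> W'" if "w \<in> W'" for w
      using that W'(2) Z_eigenvalue[OF W] vec.subspace_scale[OF sub] by (metis subsetD)
    then have "T \<subseteq> {M. \<forall>w\<in>W'. M *v w \<in> W'}"
      using is_moduleD(2)[OF W'(1)] by (intro T_subset_if_Z subalgebra_stabilizer[OF sub]) auto
    then have "is_module T W'" using sub by (auto simp: is_module_def)
    then show ?thesis using irreducible_moduleD(4)[OF W] W'(2) by blast
  qed
  then show ?thesis
    using irreducible_moduleD(1,3)[OF W] T_module_imp_Q_module by (auto simp: irreducible_module_def)
qed

text \<open>Since \<open>T\<close> is generated by \<open>Q\<close> and \<open>Z\<close>, an irreducible \<open>T\<close>-module is determined by its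
  restriction to \<open>Q\<close> and the scalar by which \<open>Z\<close> acts.\<close>

lemma Q_iso_same_eigenvalue_imp_T_iso:
  assumes U: "irreducible_module T U" and W: "irreducible_module T W"
    and iso: "vector_space_iso U W \<sigma>"
    and comm: "\<And>M u. M \<in> Q \<Longrightarrow> u \<in> U \<Longrightarrow> \<sigma> (M *v u) = M *v \<sigma> u"
    and eq: "eigenvalue U = eigenvalue W"
  shows "isomorphic_modules T U W"
proof -
  note Um = irreducible_moduleD(1,2)[OF U]
  have "\<sigma> (Z *v u) = Z *v \<sigma> u" if "u \<in> U" for u
    using that iso Z_eigenvalue[OF U that] Z_eigenvalue[OF W, of "\<sigma> u"]
    by (auto simp: vector_space_iso_def bij_betw_def eq)
  then have "T \<subseteq> {M. \<forall>u\<in>U. M *v u \<in> U \<and> \<sigma> (M *v u) = M *v \<sigma> u}"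
    using is_moduleD(2)[OF T_module_imp_Q_module[OF Um(1)]] is_moduleD(2)[OF Um(1) Z_in_T] comm
    by (intro T_subset_if_Z subalgebra_intertwiners[OF Um(2) iso]) auto
  then show ?thesis using iso by (auto simp: isomorphic_modules_def)
qed

lemma T_iso_imp_same_eigenvalue:
  assumes U: "irreducible_module T U" and W: "irreducible_module T W"
    and "isomorphic_modules T U W"
  shows "eigenvalue U = eigenvalue W"
proof -
  obtain \<sigma> where iso: "vector_space_iso U W \<sigma>"
    and comm: "\<And>M u. M \<in> T \<Longrightarrow> u \<in> U \<Longrightarrow> \<sigma> (M *v u) = M *v \<sigma> u"
    using assms(3) by (auto simp: isomorphic_modules_def)
  obtain u where u: "u \<in> U" "u \<noteq> 0" using irreducible_module_nonzero_vector[OF U] .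
  have U0: "0 \<in> U" using irreducible_moduleD(2)[OF U] by (rule vec.subspace_0)
  have "\<sigma> 0 = 0"
    using iso U0 unfolding vector_space_iso_def by (metis vec.scale_zero_left)
  then have "\<sigma> u \<noteq> 0"
    using iso u U0 by (metis vector_space_iso_def bij_betw_def inj_onD)
  moreover have "eigenvalue U *s \<sigma> u = eigenvalue W *s \<sigma> u"
  proof -
    have "eigenvalue U *s \<sigma> u = \<sigma> (Z *v u)"
      using iso u by (simp add: Z_eigenvalue[OF U] vector_space_iso_def)
    also have "\<dots> = Z *v \<sigma> u" using comm[OF Z_in_T u(1)] .
    also have "\<dots> = eigenvalue W *s \<sigma> u"
      using iso u by (intro Z_eigenvalue[OF W]) (auto simp: vector_space_iso_def bij_betw_def)
    finally show ?thesis .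
  qed
  ultimately show ?thesis by simp
qed

text \<open>
  As a left \<open>Q\<close>-module, the matrix algebra is a direct sum of copies of \<open>V\<close>, one for each column.
  The blocks of the projection onto \<open>Q\<close> for this decomposition are endomorphisms of the
  \<open>Q\<close>-module \<open>V\<close>.
\<close>

definition only_column :: "'a \<Rightarrow> complex^'a \<Rightarrow> complex^'a^'a" where
  "only_column w v = (\<chi> i j. if j = w then v $ i else 0)"

definition block :: "'a \<Rightarrow> 'a \<Rightarrow> complex^'a \<Rightarrow> complex^'a" where
  "block y w v = column y (proj Q (only_column w v))"

lemma block_add: "block y w (u + v) = block y w u + block y w v"
proof -
  have "only_column w (u + v) = only_column w u + only_column w v"
    by (simp add: only_column_def vec_eq_iff)
  then show ?thesis
    by (simp add: block_def proj_add subalgebra_imp_subspace Q) (simp add: column_def vec_eq_iff)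
qed

lemma block_scale: "block y w (c *s u) = c *s block y w u"
proof -
  have "only_column w (c *s u) = cscale c (only_column w u)"
    by (simp add: only_column_def cscale_def vec_eq_iff)
  then show ?thesis
    by (simp add: block_def proj_cscale) (simp add: column_def cscale_def vec_eq_iff)
qed

lemma block_commute:
  assumes "M \<in> Q"
  shows "block y w (M *v u) = M *v block y w u"
proof -
  have "only_column w (M *v u) = M ** only_column w u"
    by (simp add: only_column_def vec_eq_iff matrix_vector_mult_def matrix_matrix_mult_def)
  then show ?thesis
    by (simp add: block_def proj_left_mult[OF assms] column_matrix_mult)
qed

lemma column_proj: "column y (proj Q M) = (\<Sum>w\<in>UNIV. block y w (column w M))"
proof -
  have "proj Q (\<Sum>w\<in>I. f w) = (\<Sum>w\<in>I. proj Q (f w))" for I and f :: "'a \<Rightarrow> complex^'a^'a"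
    by (induction I rule: infinite_finite_induct)
      (simp_all add: proj_add subalgebra_imp_subspace Q proj_fixed subalgebra_zero)
  moreover have "M = (\<Sum>w\<in>UNIV. only_column w (column w M))"
    by (simp add: vec_eq_iff only_column_def column_def)
  ultimately have "proj Q M = (\<Sum>w\<in>UNIV. proj Q (only_column w (column w M)))" by metis
  then show ?thesis by (simp add: block_def column_def vec_eq_iff)
qed

text \<open>
  This is the double commutant argument. If \<open>Z\<close> commuted with all blocks, then left multiplication
  by \<open>Z\<close> would commute with the projection, and applying both to the identity matrix would give
  \<open>proj Q Z = Z\<close>; but \<open>proj Q Z = 0\<close>.
\<close>

lemma exists_block_not_commuting:
  assumes "Q \<noteq> T"
  obtains y w v where "block y w (Z *v v) \<noteq> Z *v block y w v"
proof -
  have "Q = T" if comm: "\<And>y w v. block y w (Z *v v) = Z *v block y w v"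
  proof -
    have "column y (proj Q (Z ** mat 1)) = Z *v column y (proj Q (mat 1))" for y
      unfolding column_proj column_matrix_mult comm by (simp only: vec.sum)
    then have "column y (0 :: complex^'a^'a) = column y Z" for y
      using proj_fixed[OF subalgebra_one[OF Q]] by (simp add: proj_Z flip: column_matrix_mult)
    then have "Z = 0" by (simp add: column_def vec_eq_iff)
    then show ?thesis by (rule Z_eq_0_imp_Q_eq_T)
  qed
  then show ?thesis using assms that by blast
qed

text \<open>
  A block \<open>B\<close> that does not commute with \<open>Z\<close> fails to do so at a vector \<open>u\<close> of some irreducible
  \<open>U\<close>, by complete reducibility, and the defect \<open>g\<close> has a nonzero projection to some irreducible
  \<open>W\<close>. Then \<open>u \<mapsto> proj W (B u)\<close> is a nonzero \<open>Q\<close>-module map from \<open>U\<close> to \<open>W\<close>, hence an isomorphism, and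
  \<open>proj W g\<close> is the difference of the two eigenvalues of \<open>Z\<close> times the image of \<open>u\<close>.
\<close>

theorem exists_Q_iso_not_T_iso:
  assumes "Q \<noteq> T"
  obtains U W where "irreducible_module T U" "irreducible_module T W"
    "\<not> isomorphic_modules T U W" "isomorphic_modules Q U W"
proof -
  obtain y w v where "block y w (Z *v v) \<noteq> Z *v block y w v"
    using exists_block_not_commuting[OF assms] .
  define B where "B = block y w"
  note B_add = block_add[of y w, folded B_def] and B_scale = block_scale[of y w, folded B_def]
    and B_commute = block_commute[of _ y w, folded B_def]
  have not_commuting: "B (Z *v v) \<noteq> Z *v B v" unfolding B_def by fact
  have B0: "B 0 = 0" using B_scale[of 0 0] by simp
  obtain U u where U: "irreducible_module T U" and u: "u \<in> U" "B (Z *v u) \<noteq> Z *v B u"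
  proof -
    have subspace: "vec.subspace {v. B (Z *v v) = Z *v B v}"
      by (rule vec.subspaceI)
        (simp_all add: B_add B_scale B0 matrix_vector_right_distrib vector_scalar_commute)
    have "v \<in> {v. B (Z *v v) = Z *v B v}"
      if "\<And>U u. irreducible_module T U \<Longrightarrow> u \<in> U \<Longrightarrow> B (Z *v u) = Z *v B u"
      by (rule subspace_covering_irreducibles[OF T_star subspace]) (auto simp: that)
    then show ?thesis using that not_commuting by blast
  qed
  define g where "g = B (Z *v u) - Z *v B u"
  obtain W where W: "irreducible_module T W" and "proj W g \<noteq> 0"
  proof -
    have "g \<bullet> g = 0" if zero: "\<And>W. irreducible_module T W \<Longrightarrow> proj W g = 0"
    proof -
      have inner: "g \<bullet> w = 0" if "irreducible_module T W" "w \<in> W" for W w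
        using proj_orthogonal[OF complex_subspace_imp_subspace that(2), of g]
          irreducible_moduleD(2) zero that(1) by auto
      (* The inner product is real, so orthogonality to g is imposed on all complex multiples to
         obtain a complex subspace. *)
      have subspace: "vec.subspace {w. \<forall>c. g \<bullet> (c *s w) = 0}"
        by (rule vec.subspaceI)
          (simp_all add: vec.scale_right_distrib inner_add_right)
      have cover: "W \<subseteq> {w. \<forall>c. g \<bullet> (c *s w) = 0}" if "irreducible_module T W" for W
        using inner[OF that] vec.subspace_scale[OF irreducible_moduleD(2)[OF that]] by blast
      have "g \<in> {w. \<forall>c. g \<bullet> (c *s w) = 0}"
        by (rule subspace_covering_irreducibles[OF T_star subspace cover])
      then have "g \<bullet> (1 *s g) = 0" by blast
      then show ?thesis by simp
    qed
    moreover have "g \<bullet> g \<noteq> 0" using u(2) by (simp add: g_def)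
    ultimately show ?thesis using that by blast
  qed
  note Wm = irreducible_moduleD(1,2)[OF W]
  define \<phi> where "\<phi> u = proj W (B u)" for u
  have W_subspace: "subspace W" using Wm(2) by (rule complex_subspace_imp_subspace)
  have "eigenvalue U *s \<phi> u = proj W g + eigenvalue W *s \<phi> u"
  proof -
    have "eigenvalue U *s \<phi> u = proj W (B (Z *v u))"
      by (simp add: \<phi>_def Z_eigenvalue[OF U u(1)] B_scale proj_vector_scale[OF Wm(2)])
    also have "\<dots> = proj W (g + Z *v B u)" by (simp add: g_def)
    also have "\<dots> = proj W g + Z *v \<phi> u"
      by (simp add: proj_add[OF W_subspace] proj_mult_vec[OF Wm(1) T_star Z_in_T] \<phi>_def)
    also have "Z *v \<phi> u = eigenvalue W *s \<phi> u"
      using Z_eigenvalue[OF W] proj_in[OF W_subspace] by (simp add: \<phi>_def)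
    finally show ?thesis .
  qed
  then have "eigenvalue U \<noteq> eigenvalue W" "\<phi> u \<noteq> 0"
    using \<open>proj W g \<noteq> 0\<close> by auto
  moreover have "isomorphic_modules Q U W"
  proof (rule schur_iso)
    show "irreducible_module Q U" "irreducible_module Q W"
      using U W by (simp_all add: irreducible_T_imp_irreducible_Q)
    show "\<phi> (M *v u) = M *v \<phi> u" if "M \<in> Q" for M u
      using that Q_subset_T unfolding \<phi>_def
      by (subst proj_mult_vec[OF Wm(1) T_star, symmetric]) (auto simp: B_commute)
  qed (use u \<open>\<phi> u \<noteq> 0\<close> in \<open>auto simp: \<phi>_def B_add B_scale proj_add[OF W_subspace]
      proj_vector_scale[OF Wm(2)] proj_in[OF W_subspace]\<close>)
  ultimately show ?thesis
    using that U W T_iso_imp_same_eigenvalue by blast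
qed

end

section \<open>The subconstituent algebra as a derivation extension\<close>

definition diag :: "('a::finite \<Rightarrow> complex) \<Rightarrow> complex^'a^'a" where
  "diag f = (\<chi> y z. if y = z then f y else 0)"

lemma diag_mult_left: "(diag f ** M) $ y $ z = f y * M $ y $ z"
  by (simp add: diag_def matrix_matrix_mult_def if_distrib[of "\<lambda>a. a * _"] cong: if_cong)

lemma diag_mult_right: "(M ** diag f) $ y $ z = M $ y $ z * f z"
  by (simp add: diag_def matrix_matrix_mult_def if_distrib[of "\<lambda>a. _ * a"] cong: if_cong)

lemma diag_mult_vec: "(diag f *v v) $ y = f y * v $ y"
  by (simp add: diag_def matrix_vector_mult_def if_distrib[of "\<lambda>a. a * _"] cong: if_cong)

lemma diag_mult_diag: "diag f ** diag g = diag (\<lambda>y. f y * g y)"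
  by (simp add: vec_eq_iff diag_mult_left) (simp add: diag_def)

text \<open>Lagrange interpolation: the spectral projections of a diagonal matrix are polynomials in it.\<close>

lemma diag_indicator_in_subalgebra:
  assumes S: "subalgebra S" and f: "diag f \<in> S" and I: "finite I" "range f \<subseteq> I" "a \<in> I"
  shows "diag (\<lambda>y. if f y = a then 1 else 0) \<in> S"
proof -
  have prod_in: "diag (\<lambda>y. \<Prod>b\<in>J. f y - b) \<in> S" for J
  proof (induction J rule: infinite_finite_induct)
    case (insert b J)
    have "diag f - cscale b (mat 1) = diag (\<lambda>y. f y - b)"
      by (simp add: diag_def cscale_def mat_def vec_eq_iff)
    then have "diag (\<lambda>y. f y - b) \<in> S"
      using subalgebra_diff[OF S f subalgebra_cscale[OF S subalgebra_one[OF S]]] by metis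
    then have "diag (\<lambda>y. f y - b) ** diag (\<lambda>y. \<Prod>b\<in>J. f y - b) \<in> S"
      using insert.IH by (rule subalgebra_mult[OF S])
    then show ?case using insert.hyps by (simp add: diag_mult_diag)
  qed (use subalgebra_one[OF S] in \<open>simp_all add: diag_def mat_def\<close>)
  let ?c = "\<Prod>b\<in>I - {a}. a - b"
  have "?c \<noteq> 0" using I(1) by auto
  moreover have "(\<Prod>b\<in>I - {a}. f y - b) = 0" if "f y \<noteq> a" for y
    using I that by (intro prod_zero bexI[of _ "f y"]) auto
  ultimately have "diag (\<lambda>y. if f y = a then 1 else 0) =
      cscale (1 / ?c) (diag (\<lambda>y. \<Prod>b\<in>I - {a}. f y - b))"
    by (auto simp: diag_def cscale_def vec_eq_iff)
  then show ?thesis using subalgebra_cscale[OF S prod_in] by metis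
qed

definition distance_matrix :: "('a::finite \<Rightarrow> 'a \<Rightarrow> bool) \<Rightarrow> 'a \<Rightarrow> complex^'a^'a" where
  "distance_matrix adj x = diag (\<lambda>y. of_nat (graph_dist adj x y))"

lemma Estar_eq_diag: "Estar adj x i = diag (\<lambda>y. if int (graph_dist adj x y) = i then 1 else 0)"
  by (auto simp: Estar_def diag_def vec_eq_iff)

lemma Estar_mult_vec:
  "(Estar adj x i *v v) $ y = (if int (graph_dist adj x y) = i then v $ y else 0)"
  by (simp add: Estar_eq_diag diag_mult_vec)

lemma Estar_adjacency_Estar:
  "(Estar adj x i ** adjacency_matrix adj ** Estar adj x j) $ y $ z =
     (if adj y z \<and> int (graph_dist adj x y) = i \<and> int (graph_dist adj x z) = j then 1 else 0)"
  by (simp add: Estar_eq_diag diag_mult_left diag_mult_right adjacency_matrix_def)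

lemma graph_dist_le_eccentricity: "graph_dist adj x y \<le> eccentricity adj x"
  by (simp add: eccentricity_def)

lemma lowering_entry:
  "lowering adj x $ y $ z =
     (if adj y z \<and> graph_dist adj x z = graph_dist adj x y + 1 then 1 else 0)"
proof -
  have "lowering adj x $ y $ z = (\<Sum>i\<in>{1..int (eccentricity adj x)}.
      if int (graph_dist adj x z) = i then
        (if adj y z \<and> graph_dist adj x z = graph_dist adj x y + 1 then 1 else 0) else 0)"
    unfolding lowering_def sum_component Estar_adjacency_Estar by (intro sum.cong) auto
  then show ?thesis using graph_dist_le_eccentricity[of adj x z] by auto
qed

lemma flat_entry:
  "flat adj x $ y $ z = (if adj y z \<and> graph_dist adj x z = graph_dist adj x y then 1 else 0)"
proof -
  have "flat adj x $ y $ z = (\<Sum>i\<in>{0..int (eccentricity adj x)}.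
      if int (graph_dist adj x z) = i then
        (if adj y z \<and> graph_dist adj x z = graph_dist adj x y then 1 else 0) else 0)"
    unfolding flat_def sum_component Estar_adjacency_Estar by (intro sum.cong) auto
  then show ?thesis using graph_dist_le_eccentricity[of adj x z] by auto
qed

lemma raising_entry:
  "raising adj x $ y $ z =
     (if adj y z \<and> graph_dist adj x y = graph_dist adj x z + 1 then 1 else 0)"
proof -
  have "raising adj x $ y $ z = (\<Sum>i\<in>{0..int (eccentricity adj x) - 1}.
      if int (graph_dist adj x z) = i then
        (if adj y z \<and> graph_dist adj x y = graph_dist adj x z + 1 then 1 else 0) else 0)"
    unfolding raising_def sum_component Estar_adjacency_Estar by (intro sum.cong) auto
  then show ?thesis using graph_dist_le_eccentricity[of adj x y] by auto
qed

lemma graph_dist_step: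
  assumes "connected_simple_graph adj" "adj y z"
  shows "graph_dist adj x z \<le> graph_dist adj x y + 1"
proof -
  obtain n where "(adj ^^ n) x y"
    using assms(1) unfolding connected_simple_graph_def by (meson rtranclp_imp_relpowp)
  then have "(adj ^^ graph_dist adj x y) x y" unfolding graph_dist_def by (rule LeastI)
  then have "(adj ^^ Suc (graph_dist adj x y)) x z" using assms(2) by (rule relpowp_Suc_I)
  then show ?thesis unfolding graph_dist_def[of adj x z] Suc_eq_plus1 by (rule Least_le)
qed

text \<open>An edge changes the distance to the base vertex by at most one.\<close>

lemma adjacency_matrix_decomposition:
  assumes "connected_simple_graph adj"
  shows "adjacency_matrix adj = lowering adj x + flat adj x + raising adj x"
proof -
  have "graph_dist adj x z \<le> graph_dist adj x y + 1 \<and> graph_dist adj x y \<le> graph_dist adj x z + 1"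
    if "adj y z" for y z
    using graph_dist_step[OF assms] that assms by (auto simp: connected_simple_graph_def dest: sympD)
  then show ?thesis
    by (force simp: vec_eq_iff adjacency_matrix_def lowering_entry flat_entry raising_entry)
qed

lemma Estar_out_of_range: "i \<notin> {0..int (eccentricity adj x)} \<Longrightarrow> Estar adj x i = 0"
  using graph_dist_le_eccentricity[of adj x] by (auto simp: vec_eq_iff Estar_def)

lemma subalgebra_subconstituent_algebra: "subalgebra (subconstituent_algebra adj x)"
  unfolding subconstituent_algebra_def by (rule subalgebra_hull)

lemma Estar_in_subconstituent_algebra: "Estar adj x i \<in> subconstituent_algebra adj x"
proof (cases "i \<in> {0..int (eccentricity adj x)}")
  case True
  then show ?thesis unfolding subconstituent_algebra_def by (intro hull_inc) auto
next
  case False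
  then show ?thesis
    by (simp add: Estar_out_of_range subalgebra_zero subalgebra_subconstituent_algebra)
qed

lemma quantum_generators_in_subconstituent_algebra:
  "{lowering adj x, flat adj x, raising adj x} \<subseteq> subconstituent_algebra adj x"
proof -
  note T = subalgebra_subconstituent_algebra[of adj x]
  have "adjacency_matrix adj \<in> subconstituent_algebra adj x"
    unfolding subconstituent_algebra_def by (intro hull_inc) auto
  then show ?thesis
    unfolding lowering_def flat_def raising_def
    by (auto intro!: subalgebra_sum[OF T] subalgebra_mult[OF T] Estar_in_subconstituent_algebra)
qed

text \<open>
  \<open>Q\<close> is self-adjoint because \<open>L\<close> and \<open>R\<close> are adjoint to each other and \<open>F\<close> is Hermitian.
  The commutator with the distance matrix preserves \<open>Q\<close> because it scales \<open>L\<close>, \<open>F\<close>, \<open>R\<close> by \<open>-1\<close>, \<open>0\<close>, \<open>1\<close>.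
\<close>

lemma subconstituent_derivation_extension:
  assumes G: "connected_simple_graph adj"
  shows "derivation_extension (quantum_adjacency_algebra adj x) (subconstituent_algebra adj x)
    (distance_matrix adj x)"
proof -
  define Q T where "Q = quantum_adjacency_algebra adj x" and "T = subconstituent_algebra adj x"
  let ?L = "lowering adj x" and ?F = "flat adj x" and ?R = "raising adj x"
    and ?K = "distance_matrix adj x" and ?D = "int (eccentricity adj x)"
  have sym: "adj y z \<longleftrightarrow> adj z y" for y z
    using G by (auto simp: connected_simple_graph_def dest: sympD)
  have Q: "subalgebra Q" and T: "subalgebra T"
    by (simp_all add: Q_def T_def quantum_adjacency_algebra_def subalgebra_hull
        subalgebra_subconstituent_algebra)
  have Q_min: "Q \<subseteq> S" if "subalgebra S" "?L \<in> S" "?F \<in> S" "?R \<in> S" for S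
    unfolding Q_def quantum_adjacency_algebra_def using that by (intro hull_minimal) auto
  have gens: "?L \<in> Q" "?F \<in> Q" "?R \<in> Q"
    unfolding Q_def quantum_adjacency_algebra_def by (auto intro: hull_inc)
  have star: "conj_transpose ?L = ?R" "conj_transpose ?F = ?F" "conj_transpose ?R = ?L"
    by (auto simp: conj_transpose_def vec_eq_iff lowering_entry flat_entry raising_entry sym)
  have "Q \<subseteq> {M. conj_transpose M \<in> Q}"
    by (rule Q_min) (simp_all add: subalgebra_conj_transpose Q star gens)
  moreover have "conj_transpose ?K = ?K"
    by (auto simp: conj_transpose_def distance_matrix_def diag_def vec_eq_iff)
  moreover have "Q \<subseteq> T"
    using quantum_generators_in_subconstituent_algebra by (intro Q_min T) (auto simp: T_def)
  moreover have "?K \<in> T"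
  proof -
    have "?K = (\<Sum>i\<in>{0..?D}. cscale (of_int i) (Estar adj x i))"
    proof -
      have "(\<Sum>i\<in>{0..?D}. cscale (of_int i) (Estar adj x i)) $ y $ z = ?K $ y $ z" for y z
      proof -
        have "(\<Sum>i\<in>{0..?D}. cscale (of_int i) (Estar adj x i)) $ y $ z =
            (\<Sum>i\<in>{0..?D}. if int (graph_dist adj x y) = i then ?K $ y $ z else 0)"
          unfolding sum_component
          by (intro sum.cong) (auto simp: cscale_def Estar_def distance_matrix_def diag_def)
        then show ?thesis using graph_dist_le_eccentricity[of adj x y] by auto
      qed
      then show ?thesis by (simp add: vec_eq_iff)
    qed
    also have "\<dots> \<in> T"
      unfolding T_def
      by (intro subalgebra_sum subalgebra_cscale subalgebra_subconstituent_algebra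
          Estar_in_subconstituent_algebra)
    finally show ?thesis .
  qed
  moreover have "Q \<subseteq> {M \<in> Q. ?K ** M - M ** ?K \<in> Q}"
  proof (rule Q_min)
    have "?K ** ?L - ?L ** ?K = 0 - ?L" "?K ** ?F - ?F ** ?K = 0" "?K ** ?R - ?R ** ?K = ?R"
      by (auto simp: vec_eq_iff distance_matrix_def diag_mult_left diag_mult_right lowering_entry
          flat_entry raising_entry)
    then show "?L \<in> {M \<in> Q. ?K ** M - M ** ?K \<in> Q}" "?F \<in> {M \<in> Q. ?K ** M - M ** ?K \<in> Q}"
        "?R \<in> {M \<in> Q. ?K ** M - M ** ?K \<in> Q}"
      using gens subalgebra_diff[OF Q subalgebra_zero[OF Q] gens(1)]
      by (simp_all add: subalgebra_zero[OF Q])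
  qed (rule subalgebra_commutator_in[OF Q])
  moreover have "T \<subseteq> S" if S: "subalgebra S" and QS: "Q \<subseteq> S" and KS: "?K \<in> S" for S
    unfolding T_def subconstituent_algebra_def
  proof (intro hull_minimal subsetI)
    fix M assume "M \<in> insert (adjacency_matrix adj) (Estar adj x ` {0..?D})"
    then consider "M = adjacency_matrix adj" | i where "i \<in> {0..?D}" "M = Estar adj x i" by auto
    then show "M \<in> S"
    proof cases
      case 1
      then show ?thesis
        using QS gens by (auto simp: adjacency_matrix_decomposition[OF G, of x]
            intro!: subalgebra_add[OF S])
    next
      case (2 i)
      have "diag (\<lambda>y. if of_nat (graph_dist adj x y) = (of_int i :: complex) then 1 else 0) \<in> S"
        using 2 graph_dist_le_eccentricity[of adj x]
        by (intro diag_indicator_in_subalgebra[OF S KS[unfolded distance_matrix_def],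
              of "of_int ` {0..?D}"])
          (auto intro!: image_eqI[of _ _ "int _"])
      moreover have "of_nat k = (of_int i :: complex) \<longleftrightarrow> int k = i" for k
        by (metis of_int_eq_iff of_int_of_nat_eq)
      ultimately show ?thesis by (simp add: 2 Estar_eq_diag)
    qed
  qed (rule S)
  ultimately show ?thesis
    using Q T by (auto simp: derivation_extension_def Q_def T_def)
qed

section \<open>Quasi-isomorphisms\<close>

definition support :: "('a::finite \<Rightarrow> 'a \<Rightarrow> bool) \<Rightarrow> 'a \<Rightarrow> (complex^'a) set \<Rightarrow> int set" where
  "support adj x W = {i. \<exists>w\<in>W. Estar adj x i *v w \<noteq> 0}"

lemma support_subset: "support adj x W \<subseteq> {0..int (eccentricity adj x)}"
proof
  fix i assume "i \<in> support adj x W"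
  then obtain w y where "(Estar adj x i *v w) $ y \<noteq> 0" by (auto simp: support_def vec_eq_iff)
  then have "int (graph_dist adj x y) = i" by (auto simp: Estar_mult_vec split: if_splits)
  then show "i \<in> {0..int (eccentricity adj x)}"
    using graph_dist_le_eccentricity[of adj x y] by auto
qed

lemma finite_support: "finite (support adj x W)"
  using support_subset by (rule finite_subset) simp

lemma support_nonempty:
  assumes "w \<in> W" "w \<noteq> 0"
  shows "support adj x W \<noteq> {}"
proof -
  obtain y where "w $ y \<noteq> 0" using assms(2) by (auto simp: vec_eq_iff)
  then have "(Estar adj x (int (graph_dist adj x y)) *v w) $ y \<noteq> 0" by (simp add: Estar_mult_vec)
  then show ?thesis using assms(1) by (force simp: support_def)
qed

lemma endpoint_eq_Min_support:
  assumes "vec.subspace W"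
  shows "endpoint adj x W = Min (support adj x W)"
proof -
  have "(\<lambda>w. Estar adj x i *v w) ` W \<noteq> {0} \<longleftrightarrow> i \<in> support adj x W" for i
  proof -
    have "0 \<in> (\<lambda>w. Estar adj x i *v w) ` W"
      using vec.subspace_0[OF assms] by (force intro: image_eqI[of _ _ 0])
    then show ?thesis by (auto simp: support_def)
  qed
  then have "{i \<in> {0..int (eccentricity adj x)}. (\<lambda>w. Estar adj x i *v w) ` W \<noteq> {0}} =
      support adj x W"
    using support_subset[of adj x W] by auto
  then show ?thesis by (simp add: endpoint_def)
qed

lemma vector_space_iso_sum:
  assumes "vector_space_iso U W \<sigma>" and U: "vec.subspace U"
    and "finite I" "\<And>i. i \<in> I \<Longrightarrow> f i \<in> U"
  shows "\<sigma> (\<Sum>i\<in>I. f i) = (\<Sum>i\<in>I. \<sigma> (f i))"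
  using assms(3,4)
proof (induction I rule: finite_induct)
  case empty
  have "\<sigma> (0 *s 0) = 0 *s \<sigma> 0"
    using assms(1) vec.subspace_0[OF U] unfolding vector_space_iso_def by blast
  then show ?case by simp
next
  case (insert i I)
  then show ?case
    using assms(1) vec.subspace_sum[OF U, of I f] by (simp add: vector_space_iso_def)
qed

lemma vector_space_iso_nonzero:
  assumes iso: "vector_space_iso U W \<sigma>" and U: "vec.subspace U" and u: "u \<in> U" "u \<noteq> 0"
  shows "\<sigma> u \<noteq> 0"
  using vector_space_iso_sum[OF iso U, of "{}" "\<lambda>_. 0"] u iso vec.subspace_0[OF U]
  by (metis vector_space_iso_def bij_betw_def inj_onD finite.emptyI sum.empty empty_iff)

lemma sum_Estar_mult_vec: "(\<Sum>i\<in>{0..int (eccentricity adj x)}. Estar adj x i *v v) = v"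
  using graph_dist_le_eccentricity[of adj x] by (simp add: vec_eq_iff Estar_mult_vec)

text \<open>
  On \<open>U\<close> the map \<open>\<sigma>\<close> commutes with \<open>K - Z \<in> Q\<close>, so it shifts \<open>K\<close> by the difference \<open>c\<close> of the two
  eigenvalues of \<open>Z\<close>. As \<open>K\<close> has integer eigenvalues on both modules, \<open>c\<close> is an integer, and \<open>\<sigma>\<close>
  carries \<open>E\<^sup>*\<^sub>i U\<close> to \<open>E\<^sup>*\<^sub>i\<^sub>+\<^sub>c W\<close>.
\<close>

lemma Q_iso_shifts_Estar:
  assumes ext: "derivation_extension Q T (distance_matrix adj x)"
    and U: "irreducible_module T U" and W: "irreducible_module T W"
    and iso: "vector_space_iso U W \<sigma>"
    and comm: "\<And>M u. M \<in> Q \<Longrightarrow> u \<in> U \<Longrightarrow> \<sigma> (M *v u) = M *v \<sigma> u"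
    and Estar_in_T: "\<And>i. Estar adj x i \<in> T"
  obtains n where
    "derivation_extension.eigenvalue Q (distance_matrix adj x) W -
       derivation_extension.eigenvalue Q (distance_matrix adj x) U = of_int n"
    "\<And>i u. u \<in> U \<Longrightarrow> \<sigma> (Estar adj x i *v u) = Estar adj x (i + n) *v \<sigma> u"
proof -
  interpret derivation_extension Q T "distance_matrix adj x" by (rule ext)
  let ?K = "distance_matrix adj x" and ?E = "Estar adj x" and ?D = "int (eccentricity adj x)"
  let ?d = "graph_dist adj x"
  define c where "c = eigenvalue W - eigenvalue U"
  note Um = irreducible_moduleD(1,2)[OF U]
  have add: "\<sigma> (u + v) = \<sigma> u + \<sigma> v" and scale: "\<sigma> (a *s u) = a *s \<sigma> u" and into: "\<sigma> u \<in> W"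
    if "u \<in> U" "v \<in> U" for u v a
    using iso that by (auto simp: vector_space_iso_def bij_betw_def)
  have E_in: "?E i *v u \<in> U" if "u \<in> U" for i u
    using is_moduleD(2)[OF Um(1) Estar_in_T that] .
  have K_\<sigma>: "?K *v \<sigma> u = \<sigma> (?K *v u) + c *s \<sigma> u" if u: "u \<in> U" for u
  proof -
    have "?K *v u = (?K - Z) *v u + eigenvalue U *s u"
      by (simp add: matrix_vector_diff_complex Z_eigenvalue[OF U u])
    moreover have "(?K - Z) *v u \<in> U"
      using is_moduleD(2)[OF Um(1)] K_minus_Z_in_Q Q_subset_T u by blast
    ultimately have "\<sigma> (?K *v u) = (?K - Z) *v \<sigma> u + eigenvalue U *s \<sigma> u"
      using add scale comm[OF K_minus_Z_in_Q u] u vec.subspace_scale[OF Um(2) u] by metis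
    also have "\<dots> = ?K *v \<sigma> u - eigenvalue W *s \<sigma> u + eigenvalue U *s \<sigma> u"
      using u by (simp add: matrix_vector_diff_complex Z_eigenvalue[OF W] into)
    finally show ?thesis by (simp add: c_def vec.scale_left_diff_distrib)
  qed
  have coordinate: "of_nat (?d y) = of_int i + c" if "u \<in> U" "\<sigma> (?E i *v u) $ y \<noteq> 0" for i u y
  proof -
    have "?K *v (?E i *v u) = of_int i *s (?E i *v u)"
      by (auto simp: vec_eq_iff distance_matrix_def diag_mult_vec Estar_mult_vec)
    then have "?K *v \<sigma> (?E i *v u) = of_int i *s \<sigma> (?E i *v u) + c *s \<sigma> (?E i *v u)"
      using K_\<sigma>[OF E_in[OF that(1)]] scale E_in[OF that(1)] by metis
    then have "of_nat (?d y) * \<sigma> (?E i *v u) $ y = (of_int i + c) * \<sigma> (?E i *v u) $ y"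
      by (simp add: vec_eq_iff distance_matrix_def diag_mult_vec distrib_right)
    then show ?thesis using that(2) by simp
  qed
  obtain n where n: "c = of_int n"
  proof -
    obtain u where u: "u \<in> U" "u \<noteq> 0" using irreducible_module_nonzero_vector[OF U] .
    obtain i where "?E i *v u \<noteq> 0"
      using sum_Estar_mult_vec[of adj x u] u(2) by (metis sum.neutral)
    then have "\<sigma> (?E i *v u) \<noteq> 0"
      using vector_space_iso_nonzero[OF iso Um(2)] E_in[OF u(1)] by blast
    then obtain y where "\<sigma> (?E i *v u) $ y \<noteq> 0" by (auto simp: vec_eq_iff)
    then have "c = of_int (int (?d y) - i)" using coordinate[OF u(1)] by simp
    then show ?thesis using that by blast
  qed
  have E_\<sigma>: "?E (i + n) *v \<sigma> (?E j *v u) = (if i = j then \<sigma> (?E j *v u) else 0)"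
    if "u \<in> U" for i j u
  proof -
    have dist: "int (?d y) = j + n" if "\<sigma> (?E j *v u) $ y \<noteq> 0" for y
    proof -
      have "of_int (int (?d y)) = (of_int (j + n) :: complex)"
        using coordinate[OF \<open>u \<in> U\<close> that] by (simp add: n)
      then show ?thesis by (simp only: of_int_eq_iff)
    qed
    have "(?E (i + n) *v \<sigma> (?E j *v u)) $ y = (if i = j then \<sigma> (?E j *v u) else 0) $ y" for y
      using dist[of y] by (cases "\<sigma> (?E j *v u) $ y = 0") (simp_all add: Estar_mult_vec)
    then show ?thesis by (simp only: vec_eq_iff) simp
  qed
  have "\<sigma> (?E i *v u) = ?E (i + n) *v \<sigma> u" if u: "u \<in> U" for i u
  proof -
    have zero: "\<sigma> 0 = 0" using vector_space_iso_sum[OF iso Um(2), of "{}" "\<lambda>_. 0"] by simp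
    have "\<sigma> u = (\<Sum>j\<in>{0..?D}. \<sigma> (?E j *v u))"
      using vector_space_iso_sum[OF iso Um(2), of "{0..?D}" "\<lambda>j. ?E j *v u"] E_in[OF u]
      by (simp add: sum_Estar_mult_vec)
    then have "?E (i + n) *v \<sigma> u = (\<Sum>j\<in>{0..?D}. if i = j then \<sigma> (?E j *v u) else 0)"
      by (simp add: vec.sum E_\<sigma>[OF u])
    also have "\<dots> = (if i \<in> {0..?D} then \<sigma> (?E i *v u) else 0)" by simp
    also have "\<dots> = \<sigma> (?E i *v u)"
      using zero by (auto simp: Estar_out_of_range)
    finally show ?thesis by simp
  qed
  with that n show ?thesis by (simp add: c_def)
qed

lemma endpoint_shift:
  assumes U: "vec.subspace U" "u0 \<in> U" "u0 \<noteq> 0" and W: "vec.subspace W"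
    and iso: "vector_space_iso U W \<sigma>"
    and shift: "\<And>i u. u \<in> U \<Longrightarrow> \<sigma> (Estar adj x i *v u) = Estar adj x (i + n) *v \<sigma> u"
    and Estar_in: "\<And>i u. u \<in> U \<Longrightarrow> Estar adj x i *v u \<in> U"
  shows "endpoint adj x W = endpoint adj x U + n"
proof -
  have zero: "\<sigma> 0 = 0" using vector_space_iso_sum[OF iso U(1), of "{}" "\<lambda>_. 0"] by simp
  have "i + n \<in> support adj x W \<longleftrightarrow> i \<in> support adj x U" for i
  proof -
    have "i + n \<in> support adj x W \<longleftrightarrow> (\<exists>u\<in>U. \<sigma> (Estar adj x i *v u) \<noteq> 0)"
      using iso shift by (auto simp: support_def vector_space_iso_def bij_betw_def)
    also have "\<dots> \<longleftrightarrow> i \<in> support adj x U"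
      using vector_space_iso_nonzero[OF iso U(1) Estar_in] zero unfolding support_def by force
    finally show ?thesis .
  qed
  from this[of "_ - n"] have "support adj x W = (\<lambda>i. i + n) ` support adj x U"
    by (force intro: image_eqI[of _ _ "_ - n"])
  moreover have "Min ((\<lambda>i. i + n) ` support adj x U) = Min (support adj x U) + n"
    using support_nonempty[OF U(2,3)]
    by (intro mono_Min_commute[symmetric]) (auto simp: mono_def finite_support)
  ultimately show ?thesis by (simp add: endpoint_eq_Min_support U W)
qed

theorem theorem9p1:
  fixes adj :: "'a::finite \<Rightarrow> 'a \<Rightarrow> bool" and x :: 'a
    and T Q :: "(complex^'a^'a) set"
  assumes "connected_simple_graph adj"
  defines "T \<equiv> subconstituent_algebra adj x"
    and "Q \<equiv> quantum_adjacency_algebra adj x"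
  shows "(Q \<noteq> T \<longleftrightarrow> Q \<subset> T) \<and>
    (Q \<noteq> T \<longleftrightarrow>
      (\<exists>U W. irreducible_module T U \<and> irreducible_module T W \<and>
             \<not> isomorphic_modules T U W \<and> isomorphic_modules Q U W)) \<and>
    (Q \<noteq> T \<longleftrightarrow>
      (\<exists>U W. irreducible_module T U \<and> irreducible_module T W \<and>
             quasi_isomorphic adj x U W \<and> endpoint adj x U \<noteq> endpoint adj x W))"
    (is "?i_ii \<and> (_ \<longleftrightarrow> ?iii) \<and> (_ \<longleftrightarrow> ?iv)")
proof -
  let ?E = "Estar adj x" and ?K = "distance_matrix adj x"
  let ?gens = "{lowering adj x, flat adj x, raising adj x}"
  have ext: "derivation_extension Q T ?K"
    unfolding Q_def T_def by (rule subconstituent_derivation_extension[OF assms(1)])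
  interpret derivation_extension Q T ?K by (rule ext)
  have gens_Q: "?gens \<subseteq> Q" unfolding Q_def quantum_adjacency_algebra_def by (rule hull_subset)
  have E_T: "?E i \<in> T" for i
    unfolding T_def by (rule Estar_in_subconstituent_algebra)
  have E_closed: "?E i *v u \<in> U" if "irreducible_module T U" "u \<in> U" for U u i
    using is_moduleD(2)[OF irreducible_moduleD(1)[OF that(1)] E_T that(2)] .
  have i_iii: "?iii" if "Q \<noteq> T" using exists_Q_iso_not_T_iso[OF that] by metis
  have iii_iv: "?iv" if iii: "?iii"
  proof -
    obtain U W \<sigma> where U: "irreducible_module T U" and W: "irreducible_module T W"
      and not_T: "\<not> isomorphic_modules T U W" and iso: "vector_space_iso U W \<sigma>"
      and comm: "\<And>M u. M \<in> Q \<Longrightarrow> u \<in> U \<Longrightarrow> \<sigma> (M *v u) = M *v \<sigma> u"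
      using iii by (auto simp: isomorphic_modules_def[of Q])
    obtain n where n: "eigenvalue W - eigenvalue U = of_int n"
      and shift: "\<And>i u. u \<in> U \<Longrightarrow> \<sigma> (?E i *v u) = ?E (i + n) *v \<sigma> u"
      using Q_iso_shifts_Estar[OF ext U W iso comm E_T] by blast
    obtain u where u: "u \<in> U" "u \<noteq> 0" using irreducible_module_nonzero_vector[OF U] .
    have endpoints: "endpoint adj x W = endpoint adj x U + n"
      by (rule endpoint_shift[OF irreducible_moduleD(2)[OF U] u irreducible_moduleD(2)[OF W] iso
            shift E_closed[OF U]])
    have "n \<noteq> 0"
      using Q_iso_same_eigenvalue_imp_T_iso[OF U W iso comm] n not_T by auto
    moreover have "quasi_isomorphism adj x U W \<sigma>"
      using iso comm gens_Q shift by (simp add: quasi_isomorphism_def endpoints)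
    ultimately have "quasi_isomorphic adj x U W" "endpoint adj x U \<noteq> endpoint adj x W"
      by (auto simp: quasi_isomorphic_def endpoints)
    then show ?iv using U W by blast
  qed
  have iv_iii: "?iii" if iv: "?iv"
  proof -
    obtain U W \<sigma> where U: "irreducible_module T U" and W: "irreducible_module T W"
      and quasi: "quasi_isomorphism adj x U W \<sigma>" and "endpoint adj x U \<noteq> endpoint adj x W"
      using iv by (auto simp: quasi_isomorphic_def)
    note Um = irreducible_moduleD(1,2)[OF U]
    have iso: "vector_space_iso U W \<sigma>" using quasi by (simp add: quasi_isomorphism_def)
    have "Q \<subseteq> {M. \<forall>u\<in>U. M *v u \<in> U \<and> \<sigma> (M *v u) = M *v \<sigma> u}"
      unfolding Q_def quantum_adjacency_algebra_def
    proof (rule hull_minimal)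
      show "?gens \<subseteq> {M. \<forall>u\<in>U. M *v u \<in> U \<and> \<sigma> (M *v u) = M *v \<sigma> u}"
        using quasi gens_Q is_moduleD(2)[OF T_module_imp_Q_module[OF Um(1)]]
        by (auto simp: quasi_isomorphism_def)
    qed (rule subalgebra_intertwiners[OF Um(2) iso])
    then have "isomorphic_modules Q U W"
      using iso by (auto simp: isomorphic_modules_def)
    moreover have "\<not> isomorphic_modules T U W"
    proof
      assume "isomorphic_modules T U W"
      then obtain \<tau> where iso: "vector_space_iso U W \<tau>"
        and comm: "\<And>M u. M \<in> T \<Longrightarrow> u \<in> U \<Longrightarrow> \<tau> (M *v u) = M *v \<tau> u"
        by (auto simp: isomorphic_modules_def)
      obtain u where u: "u \<in> U" "u \<noteq> 0" using irreducible_module_nonzero_vector[OF U] .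
      have "endpoint adj x W = endpoint adj x U + 0"
        by (rule endpoint_shift[OF Um(2) u irreducible_moduleD(2)[OF W] iso _ E_closed[OF U]])
          (simp add: comm E_T)
      with \<open>endpoint adj x U \<noteq> endpoint adj x W\<close> show False by simp
    qed
    ultimately show ?iii using U W by blast
  qed
  have "?i_ii" using Q_subset_T by blast
  moreover have "Q \<noteq> T" if "?iii" using that by blast
  ultimately show ?thesis using i_iii iii_iv iv_iii by blast
qed

end
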